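(* Let $F$ be a free supermodule over a superring $R$, and let $g:F\to F$ be an idempotent $R$-linear morphism, that is, $g^2=g$. Consider the exact sequence $0\to\ker g\hookrightarrow F\xrightarrow{g}\operatorname{Im}g\to0$. Then $\ker g\oplus\operatorname{Im}g\cong F$.
   Context: A superring is a ring $R$ with identity together with additive subgroups $R_0,R_1$ such that $R=R_0\oplus R_1$, $R_\alpha R_\beta\subset R_{\alpha+\beta}$ for $\alpha,\beta\in\mathbb{Z}_2$, and $1\in R_0$. A (right) supermodule over $R$ is a right $R$-module $M=M_0\oplus M_1$ with $M_\beta R_\alpha\subset M_{\beta+\alpha}$ for all $\alpha,\beta\in\mathbb{Z}_2$. It is free if it has a basis, as a right $R$-module, formed by homogeneous elements (elements of $M_0\cup M_1$). An $R$-linear morphism is an additive map $\phi$ with $\phi(xa)=\phi(x)a$ for all $x$ and all $a\in R$. The isomorphism $\cong$ is by an $R$-linear morphism. *)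

theory Defs
  imports "HOL-Algebra.Algebra" "HOL-Library.Z2"
begin

text \<open>HOL-Algebra only provides modules over commutative rings, with the scalar on the left.
  Superrings are in general not commutative (nor supercommutative), so right modules are
  introduced here. As in HOL-Algebra, the multiplicative fields inherited from the ring record
  are unused.\<close>

record ('a, 'b) rmodule = "'b ring" +
  rsmult :: "['b, 'a] \<Rightarrow> 'b" (infixl "\<star>\<index>" 70)

locale right_module = R?: ring R + M?: abelian_group M
  for R :: "('a, 'k) ring_scheme" (structure) and M :: "('a, 'b, 'm) rmodule_scheme" (structure) +
  assumes rsmult_closed:
      "\<lbrakk>x \<in> carrier M; a \<in> carrier R\<rbrakk> \<Longrightarrow> x \<star>\<^bsub>M\<^esub> a \<in> carrier M"
    and rsmult_l_distr:
      "\<lbrakk>x \<in> carrier M; y \<in> carrier M; a \<in> carrier R\<rbrakk> \<Longrightarrow>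
        (x \<oplus>\<^bsub>M\<^esub> y) \<star>\<^bsub>M\<^esub> a = x \<star>\<^bsub>M\<^esub> a \<oplus>\<^bsub>M\<^esub> y \<star>\<^bsub>M\<^esub> a"
    and rsmult_r_distr:
      "\<lbrakk>x \<in> carrier M; a \<in> carrier R; b \<in> carrier R\<rbrakk> \<Longrightarrow>
        x \<star>\<^bsub>M\<^esub> (a \<oplus>\<^bsub>R\<^esub> b) = x \<star>\<^bsub>M\<^esub> a \<oplus>\<^bsub>M\<^esub> x \<star>\<^bsub>M\<^esub> b"
    and rsmult_assoc:
      "\<lbrakk>x \<in> carrier M; a \<in> carrier R; b \<in> carrier R\<rbrakk> \<Longrightarrow>
        x \<star>\<^bsub>M\<^esub> (a \<otimes>\<^bsub>R\<^esub> b) = (x \<star>\<^bsub>M\<^esub> a) \<star>\<^bsub>M\<^esub> b"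
    and rsmult_one:
      "x \<in> carrier M \<Longrightarrow> x \<star>\<^bsub>M\<^esub> \<one>\<^bsub>R\<^esub> = x"

text \<open>The additive group of \<open>G\<close> is the internal direct sum of the subgroups \<open>H 0\<close> and \<open>H 1\<close>,
  the index set being the two-element field \<open>bit\<close>.\<close>

definition z2_graded :: "('b, 'm) ring_scheme \<Rightarrow> (bit \<Rightarrow> 'b set) \<Rightarrow> bool" where
  "z2_graded G H \<longleftrightarrow>
     (\<forall>\<alpha>. additive_subgroup (H \<alpha>) G) \<and>
     H 0 <+>\<^bsub>G\<^esub> H 1 = carrier G \<and>
     H 0 \<inter> H 1 = {\<zero>\<^bsub>G\<^esub>}"

locale superring = ring R for R (structure) +
  fixes Rg :: "bit \<Rightarrow> 'a set"
  assumes ring_graded: "z2_graded R Rg"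
    and graded_mult: "\<lbrakk>a \<in> Rg \<alpha>; b \<in> Rg \<beta>\<rbrakk> \<Longrightarrow> a \<otimes> b \<in> Rg (\<alpha> + \<beta>)"
    and one_even: "\<one> \<in> Rg 0"

locale supermodule = superring R Rg + right_module R M
  for R :: "('a, 'k) ring_scheme" (structure) and Rg
    and M :: "('a, 'b, 'm) rmodule_scheme" (structure) +
  fixes Mg :: "bit \<Rightarrow> 'b set"
  assumes module_graded: "z2_graded M Mg"
    and graded_rsmult: "\<lbrakk>x \<in> Mg \<beta>; a \<in> Rg \<alpha>\<rbrakk> \<Longrightarrow> x \<star>\<^bsub>M\<^esub> a \<in> Mg (\<beta> + \<alpha>)"

definition rmod_span ::
    "('a, 'k) ring_scheme \<Rightarrow> ('a, 'b, 'm) rmodule_scheme \<Rightarrow> 'b set \<Rightarrow> 'b set" where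
  "rmod_span R M B =
     {x. \<exists>A c. finite A \<and> A \<subseteq> B \<and> c \<in> A \<rightarrow> carrier R \<and>
            x = (\<Oplus>\<^bsub>M\<^esub>b\<in>A. b \<star>\<^bsub>M\<^esub> c b)}"

definition rmod_independent ::
    "('a, 'k) ring_scheme \<Rightarrow> ('a, 'b, 'm) rmodule_scheme \<Rightarrow> 'b set \<Rightarrow> bool" where
  "rmod_independent R M B \<longleftrightarrow>
     (\<forall>A c. finite A \<and> A \<subseteq> B \<and> c \<in> A \<rightarrow> carrier R \<and>
            (\<Oplus>\<^bsub>M\<^esub>b\<in>A. b \<star>\<^bsub>M\<^esub> c b) = \<zero>\<^bsub>M\<^esub>
        \<longrightarrow> (\<forall>b\<in>A. c b = \<zero>\<^bsub>R\<^esub>))"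

definition rmod_basis ::
    "('a, 'k) ring_scheme \<Rightarrow> ('a, 'b, 'm) rmodule_scheme \<Rightarrow> 'b set \<Rightarrow> bool" where
  "rmod_basis R M B \<longleftrightarrow>
     B \<subseteq> carrier M \<and> rmod_independent R M B \<and> rmod_span R M B = carrier M"

locale free_supermodule = supermodule +
  assumes homogeneous_basis: "\<exists>B. B \<subseteq> Mg 0 \<union> Mg 1 \<and> rmod_basis R M B"

text \<open>Morphisms are not required to preserve the grading.\<close>

definition rmod_hom ::
    "('a, 'k) ring_scheme \<Rightarrow> ('a, 'b, 'm) rmodule_scheme \<Rightarrow> ('a, 'c, 'n) rmodule_scheme
      \<Rightarrow> ('b \<Rightarrow> 'c) set" where
  "rmod_hom R M N =
     {f \<in> hom (add_monoid M) (add_monoid N).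
        \<forall>x\<in>carrier M. \<forall>a\<in>carrier R. f (x \<star>\<^bsub>M\<^esub> a) = f x \<star>\<^bsub>N\<^esub> a}"

definition rmod_isomorphic ::
    "('a, 'k) ring_scheme \<Rightarrow> ('a, 'b, 'm) rmodule_scheme \<Rightarrow> ('a, 'c, 'n) rmodule_scheme
      \<Rightarrow> bool" where
  "rmod_isomorphic R M N \<longleftrightarrow>
     right_module R M \<and> right_module R N \<and>
     (\<exists>f\<in>rmod_hom R M N. bij_betw f (carrier M) (carrier N))"

definition rmod_ker ::
    "('a, 'b, 'm) rmodule_scheme \<Rightarrow> ('a, 'c, 'n) rmodule_scheme \<Rightarrow> ('b \<Rightarrow> 'c)
      \<Rightarrow> ('a, 'b, 'm) rmodule_scheme" where
  "rmod_ker M N f = M\<lparr>carrier := a_kernel M N f\<rparr>"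

definition rmod_im ::
    "('a, 'b, 'm) rmodule_scheme \<Rightarrow> ('a, 'c, 'n) rmodule_scheme \<Rightarrow> ('b \<Rightarrow> 'c)
      \<Rightarrow> ('a, 'c, 'n) rmodule_scheme" where
  "rmod_im M N f = N\<lparr>carrier := f ` carrier M\<rparr>"

text \<open>The external direct sum.\<close>

definition rmod_dsum ::
    "('a, 'b, 'm) rmodule_scheme \<Rightarrow> ('a, 'c, 'n) rmodule_scheme \<Rightarrow> ('a, 'b \<times> 'c) rmodule" where
  "rmod_dsum M N =
     ring.extend (RDirProd M N) \<lparr>rsmult = \<lambda>(x, y) a. (x \<star>\<^bsub>M\<^esub> a, y \<star>\<^bsub>N\<^esub> a)\<rparr>"

text \<open>Exactness of \<open>0 \<rightarrow> K \<rightarrow> M \<rightarrow> N \<rightarrow> 0\<close> with the two inner maps \<open>i\<close> and \<open>p\<close>.\<close>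

definition rmod_short_exact ::
    "('a, 'k) ring_scheme \<Rightarrow> ('a, 'b, 'l) rmodule_scheme \<Rightarrow> ('a, 'c, 'm) rmodule_scheme
      \<Rightarrow> ('a, 'd, 'n) rmodule_scheme \<Rightarrow> ('b \<Rightarrow> 'c) \<Rightarrow> ('c \<Rightarrow> 'd) \<Rightarrow> bool" where
  "rmod_short_exact R K M N i p \<longleftrightarrow>
     right_module R K \<and> right_module R M \<and> right_module R N \<and>
     i \<in> rmod_hom R K M \<and> p \<in> rmod_hom R M N \<and>
     inj_on i (carrier K) \<and> i ` carrier K = a_kernel M N p \<and> p ` carrier M = carrier N"

end

theory Submission
  imports Defs
begin

text \<open>An idempotent endomorphism \<open>g\<close> splits every element as \<open>x = (x - g x) + g x\<close>. The first
  summand lies in the kernel because \<open>g (g x) = g x\<close>, the second in the image, and \<open>g\<close> fixes every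
  point of its image. Hence addition \<open>(k, y) \<mapsto> k + y\<close> on \<open>ker g \<oplus> Im g\<close> is onto, and it is injective
  because applying \<open>g\<close> to \<open>k + y\<close> recovers \<open>y\<close>, after which \<open>k\<close> is recovered by cancellation.

  The splitting is the lemma \<open>idempotent_splits\<close> about right modules. Exactness of
  \<open>0 \<rightarrow> ker f \<rightarrow> M \<rightarrow> Im f \<rightarrow> 0\<close> holds for every morphism \<open>f\<close> by the choice of its two ends
  (\<open>ker_im_short_exact\<close>); what has to be checked is that these ends, and the external direct sum,
  are right modules again.\<close>

lemma (in right_module) zero_rsmult:
  assumes "a \<in> carrier R"
  shows "\<zero>\<^bsub>M\<^esub> \<star>\<^bsub>M\<^esub> a = \<zero>\<^bsub>M\<^esub>"
proof -
  let ?z = "\<zero>\<^bsub>M\<^esub> \<star>\<^bsub>M\<^esub> a"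
  have z: "?z \<in> carrier M"
    by (rule rsmult_closed[OF M.zero_closed assms])
  have "?z \<oplus>\<^bsub>M\<^esub> ?z = (\<zero>\<^bsub>M\<^esub> \<oplus>\<^bsub>M\<^esub> \<zero>\<^bsub>M\<^esub>) \<star>\<^bsub>M\<^esub> a"
    by (rule rsmult_l_distr[OF M.zero_closed M.zero_closed assms, symmetric])
  also have "\<dots> = ?z"
    by (simp only: M.l_zero[OF M.zero_closed])
  finally show ?thesis
    using M.add.l_cancel_one[OF z z] by (rule iffD1[rotated])
qed

lemma right_module_submodule:
  fixes R :: "('a, 'k) ring_scheme" and M :: "('a, 'b, 'm) rmodule_scheme"
  assumes "right_module R M"
    and sub: "S \<subseteq> carrier M" and zero_in: "\<zero>\<^bsub>M\<^esub> \<in> S"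
    and add_in: "\<And>x y. \<lbrakk>x \<in> S; y \<in> S\<rbrakk> \<Longrightarrow> x \<oplus>\<^bsub>M\<^esub> y \<in> S"
    and neg_in: "\<And>x. x \<in> S \<Longrightarrow> \<ominus>\<^bsub>M\<^esub> x \<in> S"
    and smult_in: "\<And>x a. \<lbrakk>x \<in> S; a \<in> carrier R\<rbrakk> \<Longrightarrow> x \<star>\<^bsub>M\<^esub> a \<in> S"
  shows "right_module R (M\<lparr>carrier := S\<rparr>)"
proof -
  interpret right_module R M by fact
  have "abelian_group (M\<lparr>carrier := S\<rparr>)"
  proof (rule abelian_groupI; simp)
    fix x assume "x \<in> S"
    then show "\<exists>y\<in>S. y \<oplus>\<^bsub>M\<^esub> x = \<zero>\<^bsub>M\<^esub>"
      using neg_in sub by (intro bexI[of _ "\<ominus>\<^bsub>M\<^esub> x"]) (auto simp: M.l_neg)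
  qed (use sub zero_in add_in in \<open>auto simp: subset_iff M.a_ac\<close>)
  then show ?thesis
    using sub smult_in R.ring_axioms
    by (auto simp: right_module_def right_module_axioms_def subset_iff
        rsmult_l_distr rsmult_r_distr rsmult_assoc rsmult_one)
qed

lemma rmod_dsum_simps:
  "carrier (rmod_dsum M N) = carrier M \<times> carrier N"
  "\<zero>\<^bsub>rmod_dsum M N\<^esub> = (\<zero>\<^bsub>M\<^esub>, \<zero>\<^bsub>N\<^esub>)"
  "(x, y) \<oplus>\<^bsub>rmod_dsum M N\<^esub> (x', y') = (x \<oplus>\<^bsub>M\<^esub> x', y \<oplus>\<^bsub>N\<^esub> y')"
  "(x, y) \<star>\<^bsub>rmod_dsum M N\<^esub> a = (x \<star>\<^bsub>M\<^esub> a, y \<star>\<^bsub>N\<^esub> a)"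
  by (simp_all add: rmod_dsum_def ring.defs RDirProd_def monoid.defs DirProd_def)

lemma right_module_dsum:
  fixes R :: "('a, 'k) ring_scheme"
    and M :: "('a, 'b, 'm) rmodule_scheme" and N :: "('a, 'c, 'n) rmodule_scheme"
  assumes "right_module R M" and "right_module R N"
  shows "right_module R (rmod_dsum M N)"
proof -
  interpret M: right_module R M by fact
  interpret N: right_module R N by fact
  have "abelian_group (rmod_dsum M N)"
  proof (rule abelian_groupI)
    fix p assume "p \<in> carrier (rmod_dsum M N)"
    then show "\<exists>q\<in>carrier (rmod_dsum M N). q \<oplus>\<^bsub>rmod_dsum M N\<^esub> p = \<zero>\<^bsub>rmod_dsum M N\<^esub>"
      by (intro bexI[of _ "(\<ominus>\<^bsub>M\<^esub> fst p, \<ominus>\<^bsub>N\<^esub> snd p)"])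
        (auto simp: rmod_dsum_simps M.M.l_neg N.M.l_neg)
  qed (auto simp: rmod_dsum_simps M.M.a_ac N.M.a_ac)
  then show ?thesis
    using M.R.ring_axioms
    by (auto simp: right_module_def right_module_axioms_def rmod_dsum_simps
        M.rsmult_closed M.rsmult_l_distr M.rsmult_r_distr M.rsmult_assoc M.rsmult_one
        N.rsmult_closed N.rsmult_l_distr N.rsmult_r_distr N.rsmult_assoc N.rsmult_one)
qed

lemma a_kernel_iff: "x \<in> a_kernel M N f \<longleftrightarrow> x \<in> carrier M \<and> f x = \<zero>\<^bsub>N\<^esub>"
  by (simp add: a_kernel_def kernel_def)

lemma rmod_homI:
  assumes "\<And>x. x \<in> carrier M \<Longrightarrow> f x \<in> carrier N"
    and "\<And>x y. \<lbrakk>x \<in> carrier M; y \<in> carrier M\<rbrakk> \<Longrightarrow> f (x \<oplus>\<^bsub>M\<^esub> y) = f x \<oplus>\<^bsub>N\<^esub> f y"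
    and "\<And>x a. \<lbrakk>x \<in> carrier M; a \<in> carrier R\<rbrakk> \<Longrightarrow> f (x \<star>\<^bsub>M\<^esub> a) = f x \<star>\<^bsub>N\<^esub> a"
  shows "f \<in> rmod_hom R M N"
  using assms by (auto simp: rmod_hom_def hom_def)

locale rmod_morphism = M: right_module R M + N: right_module R N
  for R :: "('a, 'k) ring_scheme"
    and M :: "('a, 'b, 'm) rmodule_scheme" and N :: "('a, 'c, 'n) rmodule_scheme" +
  fixes f
  assumes morphism: "f \<in> rmod_hom R M N"
begin

lemma closed: "x \<in> carrier M \<Longrightarrow> f x \<in> carrier N"
  using morphism by (auto simp: rmod_hom_def hom_def)

lemma add: "\<lbrakk>x \<in> carrier M; y \<in> carrier M\<rbrakk> \<Longrightarrow> f (x \<oplus>\<^bsub>M\<^esub> y) = f x \<oplus>\<^bsub>N\<^esub> f y"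
  using morphism by (auto simp: rmod_hom_def hom_def)

lemma smult: "\<lbrakk>x \<in> carrier M; a \<in> carrier R\<rbrakk> \<Longrightarrow> f (x \<star>\<^bsub>M\<^esub> a) = f x \<star>\<^bsub>N\<^esub> a"
  using morphism by (auto simp: rmod_hom_def)

lemma abelian_group_hom: "abelian_group_hom M N f"
  using morphism
  by (intro abelian_group_homI M.M.abelian_group_axioms N.M.abelian_group_axioms)
    (auto simp: rmod_hom_def group_hom_def group_hom_axioms_def
      M.M.a_group N.M.a_group)

lemmas zero = abelian_group_hom.hom_zero[OF abelian_group_hom]
lemmas a_inv = abelian_group_hom.hom_a_inv[OF abelian_group_hom]

lemma right_module_ker: "right_module R (rmod_ker M N f)"
  unfolding rmod_ker_def
proof (rule right_module_submodule)
  fix x a assume x: "x \<in> a_kernel M N f" and a: "a \<in> carrier R"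
  show "x \<star>\<^bsub>M\<^esub> a \<in> a_kernel M N f"
    using x a by (simp add: a_kernel_iff smult M.rsmult_closed N.zero_rsmult)
qed (auto simp: a_kernel_iff add zero a_inv M.right_module_axioms)

lemma right_module_im: "right_module R (rmod_im M N f)"
  unfolding rmod_im_def
proof (rule right_module_submodule)
  show "\<zero>\<^bsub>N\<^esub> \<in> f ` carrier M"
    using zero by (metis M.M.zero_closed image_eqI)
  fix x assume x: "x \<in> f ` carrier M"
  then show "\<ominus>\<^bsub>N\<^esub> x \<in> f ` carrier M"
    by (metis (no_types, lifting) M.M.a_inv_closed a_inv image_iff)
  show "x \<oplus>\<^bsub>N\<^esub> y \<in> f ` carrier M" if "y \<in> f ` carrier M" for y
    using x that by (metis (no_types, lifting) M.M.a_closed add image_iff)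
  show "x \<star>\<^bsub>N\<^esub> a \<in> f ` carrier M" if "a \<in> carrier R" for a
    using x that by (metis (no_types, lifting) M.rsmult_closed smult image_iff)
qed (auto simp: closed N.right_module_axioms)

lemma ker_im_short_exact: "rmod_short_exact R (rmod_ker M N f) M (rmod_im M N f) (\<lambda>x. x) f"
proof -
  have "(\<lambda>x. x) \<in> rmod_hom R (rmod_ker M N f) M"
    by (rule rmod_homI) (auto simp: rmod_ker_def a_kernel_iff)
  moreover have "f \<in> rmod_hom R M (rmod_im M N f)"
    by (rule rmod_homI) (auto simp: rmod_im_def add smult)
  ultimately show ?thesis
    using right_module_ker right_module_im M.right_module_axioms
    by (auto simp: rmod_short_exact_def rmod_ker_def rmod_im_def a_kernel_iff)
qed

end

text \<open>Addition is the isomorphism; its inverse is \<open>x \<mapsto> (x - g x, g x)\<close>.\<close>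

lemma idempotent_splits:
  fixes R :: "('a, 'k) ring_scheme" and M :: "('a, 'b, 'm) rmodule_scheme"
  assumes "right_module R M" and g: "g \<in> rmod_hom R M M"
    and idem: "\<And>x. x \<in> carrier M \<Longrightarrow> g (g x) = g x"
  shows "rmod_isomorphic R (rmod_dsum (rmod_ker M M g) (rmod_im M M g)) M"
proof -
  interpret right_module R M by fact
  interpret g: rmod_morphism R M M g
    using right_module_axioms g by (simp add: rmod_morphism_def rmod_morphism_axioms_def)
  let ?D = "rmod_dsum (rmod_ker M M g) (rmod_im M M g)"
  let ?s = "\<lambda>(k, y). k \<oplus>\<^bsub>M\<^esub> y"
  have fixed_points: "g ` carrier M = {y \<in> carrier M. g y = y}"
  proof
    show "g ` carrier M \<subseteq> {y \<in> carrier M. g y = y}"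
      using g.closed idem by blast
  qed force
  have carrier_D: "p \<in> carrier ?D \<longleftrightarrow>
      (\<exists>k y. p = (k, y) \<and> k \<in> carrier M \<and> g k = \<zero>\<^bsub>M\<^esub> \<and> y \<in> carrier M \<and> g y = y)" for p
    by (cases p) (auto simp: rmod_dsum_simps rmod_ker_def rmod_im_def a_kernel_iff fixed_points)
  have ops_D: "(k, y) \<oplus>\<^bsub>?D\<^esub> (k', y') = (k \<oplus>\<^bsub>M\<^esub> k', y \<oplus>\<^bsub>M\<^esub> y')"
    "(k, y) \<star>\<^bsub>?D\<^esub> a = (k \<star>\<^bsub>M\<^esub> a, y \<star>\<^bsub>M\<^esub> a)" for k k' y y' a
    by (simp_all add: rmod_dsum_simps rmod_ker_def rmod_im_def)
  have "?s \<in> rmod_hom R ?D M"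
    by (rule rmod_homI) (auto simp: carrier_D ops_D rsmult_l_distr M.a_ac)
  moreover have "bij_betw ?s (carrier ?D) (carrier M)"
  proof (rule bij_betwI[where g = "\<lambda>x. (x \<ominus>\<^bsub>M\<^esub> g x, g x)"])
    have g_diff: "g (x \<ominus>\<^bsub>M\<^esub> g x) = \<zero>\<^bsub>M\<^esub>" if "x \<in> carrier M" for x
      using that by (simp add: a_minus_def g.add g.a_inv g.closed idem M.r_neg)
    show "(\<lambda>x. (x \<ominus>\<^bsub>M\<^esub> g x, g x)) \<in> carrier M \<rightarrow> carrier ?D"
      by (auto simp: carrier_D g_diff g.closed idem)
    show "?s (x \<ominus>\<^bsub>M\<^esub> g x, g x) = x" if "x \<in> carrier M" for x
      using that by (simp add: a_minus_def M.a_assoc M.l_neg g.closed)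
    show "(?s p \<ominus>\<^bsub>M\<^esub> g (?s p), g (?s p)) = p" if "p \<in> carrier ?D" for p
      using that by (auto simp: carrier_D g.add a_minus_def M.a_assoc M.r_neg)
  qed (auto simp: carrier_D)
  ultimately show ?thesis
    using right_module_dsum[OF g.right_module_ker g.right_module_im] right_module_axioms
    unfolding rmod_isomorphic_def by blast
qed

theorem proposition4p5:
  fixes R :: "('a, 'k) ring_scheme" and Rg :: "bit \<Rightarrow> 'a set"
    and F :: "('a, 'b, 'm) rmodule_scheme" and Fg :: "bit \<Rightarrow> 'b set"
    and g :: "'b \<Rightarrow> 'b"
  assumes "free_supermodule R Rg F Fg"
    and "g \<in> rmod_hom R F F"
    and "\<forall>x\<in>carrier F. g (g x) = g x"
  shows "rmod_short_exact R (rmod_ker F F g) F (rmod_im F F g) (\<lambda>x. x) g \<and>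
         rmod_isomorphic R (rmod_dsum (rmod_ker F F g) (rmod_im F F g)) F"
proof -
  have F: "right_module R F"
    using assms(1) by (simp add: free_supermodule_def supermodule_def)
  then interpret rmod_morphism R F F g
    using assms(2) by (simp add: rmod_morphism_def rmod_morphism_axioms_def)
  show ?thesis
    using ker_im_short_exact idempotent_splits[OF F assms(2)] assms(3) by blast
qed

end
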